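(* Let $0<p<\infty$, $-1<\alpha<\infty$, and let $C$ be any convex curve in $\mathbb{D}$. There is a positive constant $K_{p,\alpha,C}$, depending only on $p$, $\alpha$ and $C$, such that for every $f\in a_\alpha^p$, $$\int_C |f(z)|^p(1-|z|^2)^{1+\alpha}\,|dz|\le K_{p,\alpha,C}\int_{\mathbb{D}}|f(z)|^p(1-|z|^2)^\alpha\,dA(z).$$
   Context: $\mathbb{D}=\{z\in\mathbb{C}:|z|<1\}$. $dA(z)=\frac{1}{\pi}\,dx\,dy$ is normalized area measure on $\mathbb{D}$, and for $\alpha>-1$, $dA_\alpha(z)=(\alpha+1)(1-|z|^2)^\alpha\,dA(z)$. For $0<p<\infty$, $\alpha>-1$, the weighted harmonic Bergman space $a_\alpha^p$ is the set of complex-valued harmonic functions $f$ on $\mathbb{D}$ (i.e. $f=u+iv$ with $u,v$ real-valued harmonic) with $\int_{\mathbb{D}}|f|^p\,dA_\alpha<\infty$. A convex curve in $\mathbb{D}$ is a simple closed curve contained in $\mathbb{D}$ that bounds a convex region (in particular it is a compact subset of $\mathbb{D}$). $|dz|$ is arc length. *)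

theory Defs
  imports "HOL-Analysis.Analysis"
begin

abbreviation unit_disc :: "complex set" where
  "unit_disc \<equiv> ball 0 1"

text \<open>A real-valued function is harmonic on the open set \<open>S\<close> if it is \<open>C\<^sup>2\<close> there and its
  Laplacian vanishes. The suffixes \<open>x\<close>, \<open>y\<close> below denote partial derivatives in \<open>x = Re z\<close> and
  \<open>y = Im z\<close>; for instance \<open>uxy\<close> is the \<open>y\<close>-derivative of \<open>ux\<close>.\<close>

definition harmonic_on :: "complex set \<Rightarrow> (complex \<Rightarrow> real) \<Rightarrow> bool" where
  "harmonic_on S u \<longleftrightarrow>
    (\<exists>ux uy uxx uxy uyx uyy.
      continuous_on S uxx \<and> continuous_on S uxy \<and> continuous_on S uyx \<and> continuous_on S uyy \<and>
      (\<forall>z\<in>S.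
        (u has_derivative (\<lambda>h. ux z * Re h + uy z * Im h)) (at z) \<and>
        (ux has_derivative (\<lambda>h. uxx z * Re h + uxy z * Im h)) (at z) \<and>
        (uy has_derivative (\<lambda>h. uyx z * Re h + uyy z * Im h)) (at z) \<and>
        uxx z + uyy z = 0))"

definition complex_harmonic_on :: "complex set \<Rightarrow> (complex \<Rightarrow> complex) \<Rightarrow> bool" where
  "complex_harmonic_on S f \<longleftrightarrow>
    harmonic_on S (\<lambda>z. Re (f z)) \<and> harmonic_on S (\<lambda>z. Im (f z))"

definition disc_area :: "complex measure" where
  "disc_area = density (restrict_space lborel unit_disc) (\<lambda>_. ennreal (1 / pi))"

definition weighted_disc_area :: "real \<Rightarrow> complex measure" where
  "weighted_disc_area \<alpha> =
    density disc_area (\<lambda>z. ennreal ((\<alpha> + 1) * (1 - (cmod z)\<^sup>2) powr \<alpha>))"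

text \<open>The measures above live on the disc, so only the values of \<open>f\<close> on the disc matter.\<close>

definition harmonic_bergman :: "real \<Rightarrow> real \<Rightarrow> (complex \<Rightarrow> complex) set" where
  "harmonic_bergman p \<alpha> =
    {f. complex_harmonic_on unit_disc f \<and>
        (\<integral>\<^sup>+ z. ennreal (cmod (f z) powr p) \<partial>weighted_disc_area \<alpha>) < \<infinity>}"

definition simple_closed_param :: "(real \<Rightarrow> complex) \<Rightarrow> complex set \<Rightarrow> bool" where
  "simple_closed_param g C \<longleftrightarrow>
    simple_path g \<and> pathfinish g = pathstart g \<and> path_image g = C"

text \<open>By the Jordan curve theorem, the region bounded by a simple closed curve is its \<open>inside\<close>.\<close>

definition convex_curve :: "complex set \<Rightarrow> bool" where
  "convex_curve C \<longleftrightarrow> (\<exists>g. simple_closed_param g C) \<and> convex (inside C)"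

text \<open>Length of the restriction of a path to \<open>{a..b}\<close>: the supremum of the lengths of the
  inscribed polygons.\<close>

definition path_length_between :: "(real \<Rightarrow> complex) \<Rightarrow> real \<Rightarrow> real \<Rightarrow> ennreal" where
  "path_length_between g a b =
    Sup {ennreal (\<Sum>i<n. dist (g (t i)) (g (t (Suc i)))) | (n::nat) (t::nat \<Rightarrow> real).
          mono_on {..n} t \<and> t 0 = a \<and> t n = b}"

text \<open>The Stieltjes measure of the arc-length function, extended to be constant outside
  \<open>{0..1}\<close>. This is meaningful for rectifiable paths, for which the arc-length function is finite
  and continuous; convex curves are rectifiable.\<close>

definition arc_length_measure :: "(real \<Rightarrow> complex) \<Rightarrow> real measure" where
  "arc_length_measure g =
    interval_measure (\<lambda>t. enn2real (path_length_between g 0 (max 0 (min 1 t))))"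

definition arc_length_integral :: "(real \<Rightarrow> complex) \<Rightarrow> (complex \<Rightarrow> real) \<Rightarrow> ennreal" where
  "arc_length_integral g h = (\<integral>\<^sup>+ t\<in>{0..1}. ennreal (h (g t)) \<partial>arc_length_measure g)"

end

theory Submission
  imports Defs
begin

text \<open>On a compact subset of the disc the weights are bounded above and below, so the theorem reduces
  to two facts: \<open>\<bar>f w\<bar>\<^sup>p\<close> is at most a constant times the area integral of \<open>\<bar>f\<bar>\<^sup>p\<close> over a disc
  about \<open>w\<close>, for every \<open>p > 0\<close>; and all parametrizations of a convex curve have bounded length.

  For \<open>p = 1\<close> the first fact comes from a mean value property with the radial weight
  \<open>\<eta> z = max 0 (1 - \<bar>z\<bar>\<^sup>2)\<close>: as \<open>z \<eta> z\<close> is the gradient of \<open>\<Psi> = - \<eta>\<^sup>2 / 4\<close>, integration by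
  parts turns the \<open>t\<close>-derivative of \<open>\<integral> u (w + t z) \<eta> z\<close> into \<open>- t \<integral> \<Delta>u (w + t z) \<Psi> z = 0\<close>.
  For the second fact, the length is at most the sum of the variations of the two coordinates, and
  almost every line parallel to an axis meets a convex curve at most twice.\<close>

section \<open>Weighted mean values of harmonic functions\<close>

text \<open>Squaring removes the corner of the truncation at 0, where the difference quotient is at
  most \<open>\<bar>h\<bar>\<close>. This makes the potential of the bump differentiable across the
  unit circle.\<close>

lemma has_real_derivative_max_0_square:
  "((\<lambda>s::real. (max 0 s)\<^sup>2) has_real_derivative 2 * max 0 s) (at s)"
proof -
  consider "s > 0" | "s < 0" | "s = 0" by linarith
  then show ?thesis
  proof cases
    case 1
    have "((\<lambda>s::real. s\<^sup>2) has_real_derivative 2 * max 0 s) (at s)"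
      using 1 by (auto intro!: derivative_eq_intros)
    then show ?thesis
      by (rule has_field_derivative_transform_within_open[where S="{0<..}"]) (use 1 in auto)
  next
    case 2
    have "((\<lambda>s::real. 0) has_real_derivative 2 * max 0 s) (at s)"
      using 2 by (auto intro!: derivative_eq_intros)
    then show ?thesis
      by (rule has_field_derivative_transform_within_open[where S="{..<0}"]) (use 2 in auto)
  next
    case 3
    have "((\<lambda>h::real. (max 0 h)\<^sup>2 / h) \<longlongrightarrow> 0) (at 0)"
    proof (rule Lim_null_comparison)
      show "\<forall>\<^sub>F h in at 0. norm ((max 0 h)\<^sup>2 / h) \<le> \<bar>h\<bar>" for h :: real
        by (intro always_eventually allI) (auto simp: max_def power2_eq_square)
      show "((\<lambda>h::real. \<bar>h\<bar>) \<longlongrightarrow> 0) (at 0)"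
        by (intro tendsto_eq_intros) auto
    qed
    then show ?thesis using 3 by (simp add: DERIV_def)
  qed
qed

text \<open>On a line parallel to an axis the bump is \<open>max 0 (1 - x\<^sup>2 - c)\<close>, with
  \<open>c\<close> the square of the fixed coordinate. The boundary terms vanish because the
  truncation is 0 at \<open>x = 1\<close> and \<open>x = -1\<close>.\<close>

lemma integral_by_parts_bump:
  fixes h h' :: "real \<Rightarrow> real"
  assumes h: "\<And>x. x \<in> {-1..1} \<Longrightarrow> (h has_real_derivative h' x) (at x)"
    and h': "continuous_on {-1..1} h'" and "0 \<le> c"
  shows "integral {-1..1} (\<lambda>x. h x * (x * max 0 (1 - x\<^sup>2 - c))) =
    integral {-1..1} (\<lambda>x. h' x * ((max 0 (1 - x\<^sup>2 - c))\<^sup>2 / 4))"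
proof -
  \<comment> \<open>The potential with its sign reversed, which absorbs the minus sign of
    integration by parts.\<close>
  define \<Psi> where "\<Psi> x = (max 0 (1 - x\<^sup>2 - c))\<^sup>2 / 4" for x
  have \<Psi>: "(\<Psi> has_real_derivative - (x * max 0 (1 - x\<^sup>2 - c))) (at x)" for x
    unfolding \<Psi>_def
    by (rule derivative_eq_intros DERIV_chain2[OF has_real_derivative_max_0_square] refl | simp)+
  have conth: "continuous_on {-1..1} h"
    by (rule DERIV_continuous_on[where D=h']) (use h has_field_derivative_at_within in blast)
  have int1: "(\<lambda>x. h' x * \<Psi> x) integrable_on {-1..1}"
    unfolding \<Psi>_def by (intro integrable_continuous_real continuous_intros h') auto
  have int2: "(\<lambda>x. h x * (x * max 0 (1 - x\<^sup>2 - c))) integrable_on {-1..1}"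
    by (intro integrable_continuous_real continuous_intros conth)
  have "((\<lambda>x. h' x * \<Psi> x - h x * (x * max 0 (1 - x\<^sup>2 - c))) has_integral
      (h 1 * \<Psi> 1 - h (-1) * \<Psi> (-1))) {-1..1}"
  proof (rule fundamental_theorem_of_calculus)
    fix x :: real assume "x \<in> {-1..1}"
    then have "((\<lambda>x. h x * \<Psi> x) has_real_derivative
        h' x * \<Psi> x - h x * (x * max 0 (1 - x\<^sup>2 - c))) (at x)"
      by (auto intro!: derivative_eq_intros h \<Psi>)
    then show "((\<lambda>x. h x * \<Psi> x) has_vector_derivative
        h' x * \<Psi> x - h x * (x * max 0 (1 - x\<^sup>2 - c))) (at x within {-1..1})"
      by (simp add: has_real_derivative_iff_has_vector_derivative has_vector_derivative_at_within)
  qed simp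
  moreover have "\<Psi> 1 = 0" "\<Psi> (-1) = 0" using \<open>0 \<le> c\<close> by (auto simp: \<Psi>_def max_def)
  ultimately have "integral {-1..1} (\<lambda>x. h' x * \<Psi> x - h x * (x * max 0 (1 - x\<^sup>2 - c))) = 0"
    by (simp add: integral_unique)
  then show ?thesis using int1 int2 by (simp add: integral_diff \<Psi>_def)
qed

text \<open>Defined on pairs of reals, where integrals over a square are iterated integrals. It
  vanishes off the unit disc, so weighted means over the disc can be taken over
  \<open>square\<close>.\<close>

definition bump :: "real \<times> real \<Rightarrow> real" where
  "bump z = max 0 (1 - (fst z)\<^sup>2 - (snd z)\<^sup>2)"

lemma continuous_on_bump [continuous_intros]: "continuous_on A bump"
  unfolding bump_def by (intro continuous_intros)

abbreviation square :: "(real \<times> real) set" where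
  "square \<equiv> cbox (-1, -1) (1, 1)"

lemma integral_bump_pos: "0 < integral square bump"
proof -
  have "0 \<le> integral square bump"
    by (intro integral_nonneg integrable_continuous continuous_intros) (auto simp: bump_def)
  moreover have "integral square bump \<noteq> 0"
  proof
    assume "integral square bump = 0"
    then have "(bump has_integral 0) square"
      by (metis integrable_integral integrable_continuous continuous_on_bump)
    then have "bump (0,0) = 0"
      by (rule has_integral_0_cbox_imp_0[rotated 2])
        (auto simp: bump_def box_eq_empty Basis_prod_def cbox_Pair_eq intro!: continuous_intros)
    then show False by (simp add: bump_def)
  qed
  ultimately show ?thesis by simp
qed

text \<open>Integration by parts acts on the inner integral, so the derivative in \<open>x\<close>
  needs this order of iteration and the derivative in \<open>y\<close> the other one.\<close>

lemma integral_square_fst: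
  assumes "continuous_on square (f :: real \<times> real \<Rightarrow> real)"
  shows "integral square f = integral {-1..1} (\<lambda>y. integral {-1..1} (\<lambda>x. f (x, y)))"
proof -
  have "integral square f = integral (cbox (-1) 1) (\<lambda>x. integral (cbox (-1) 1) (\<lambda>y. f (x, y)))"
    by (rule integral_prod_continuous) fact
  also have "\<dots> = integral (cbox (-1) 1) (\<lambda>y. integral (cbox (-1) 1) (\<lambda>x. f (x, y)))"
    by (rule integral_swap_continuous) (use assms in \<open>simp add: case_prod_unfold\<close>)
  finally show ?thesis by simp
qed

lemma integral_square_snd:
  assumes "continuous_on square (f :: real \<times> real \<Rightarrow> real)"
  shows "integral square f = integral {-1..1} (\<lambda>x. integral {-1..1} (\<lambda>y. f (x, y)))"
  using integral_prod_continuous[OF assms] by simp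

text \<open>The weighted mean over the square scaled by \<open>t\<close> is constant for
  \<open>t\<close> in \<open>{0..r}\<close>, and at \<open>t = 0\<close> it is the value at the
  centre times the mass of the bump.\<close>

lemma harmonic_on_bump_mean:
  assumes u: "harmonic_on S u" and "0 \<le> r"
    and S: "\<And>x y. \<bar>x\<bar> \<le> r \<Longrightarrow> \<bar>y\<bar> \<le> r \<Longrightarrow> w + Complex x y \<in> S"
  shows "integral square (\<lambda>z. u (w + Complex (r * fst z) (r * snd z)) * bump z) =
    u w * integral square bump"
proof -
  obtain ux uy uxx uxy uyx uyy where
    cont: "continuous_on S uxx" "continuous_on S uxy" "continuous_on S uyx" "continuous_on S uyy" and
    D: "\<forall>z\<in>S. (u has_derivative (\<lambda>h. ux z * Re h + uy z * Im h)) (at z) \<and>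
        (ux has_derivative (\<lambda>h. uxx z * Re h + uxy z * Im h)) (at z) \<and>
        (uy has_derivative (\<lambda>h. uyx z * Re h + uyy z * Im h)) (at z) \<and>
        uxx z + uyy z = 0"
    using u unfolding harmonic_on_def by (elim exE conjE) (rule that)
  have
    du: "\<And>z. z \<in> S \<Longrightarrow> (u has_derivative (\<lambda>h. ux z * Re h + uy z * Im h)) (at z)" and
    dux: "\<And>z. z \<in> S \<Longrightarrow> (ux has_derivative (\<lambda>h. uxx z * Re h + uxy z * Im h)) (at z)" and
    duy: "\<And>z. z \<in> S \<Longrightarrow> (uy has_derivative (\<lambda>h. uyx z * Re h + uyy z * Im h)) (at z)" and
    lap: "\<And>z. z \<in> S \<Longrightarrow> uxx z + uyy z = 0"
    using D by simp_all
  have contu: "continuous_on S u" "continuous_on S ux" "continuous_on S uy"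
    by (rule has_derivative_continuous_on, erule has_derivative_at_withinI[OF du] has_derivative_at_withinI[OF dux] has_derivative_at_withinI[OF duy])+
  define P where "P t z = w + Complex (t * fst z) (t * snd z)" for t and z :: "real \<times> real"
  have PS: "P t z \<in> S" if "t \<in> {0..r}" "z \<in> square" for t z
  proof -
    have "\<bar>t * fst z\<bar> \<le> r * 1" "\<bar>t * snd z\<bar> \<le> r * 1"
      using that unfolding abs_mult by (cases z; intro mult_mono; auto simp: cbox_Pair_eq)+
    then show ?thesis unfolding P_def by (intro S) auto
  qed
  have contP: "continuous_on ({0..r} \<times> square) (\<lambda>(t, z). P t z)"
    unfolding P_def Complex_eq case_prod_unfold by (intro continuous_intros)
  have contPt: "continuous_on A (P t)" for t A
    unfolding P_def Complex_eq by (intro continuous_intros)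
  have contcomp: "continuous_on square (\<lambda>z. v (P t z))" if "continuous_on S v" "t \<in> {0..r}" for v :: "complex \<Rightarrow> real" and t
    by (rule continuous_on_compose2[OF that(1) contPt]) (use PS that in auto)
  have contcomp2: "continuous_on ({0..r} \<times> square) (\<lambda>q. v (P (fst q) (snd q)))" if "continuous_on S v" for v :: "complex \<Rightarrow> real"
    by (rule continuous_on_compose2[OF that contP[unfolded case_prod_unfold]]) (use PS in auto)
  define J where "J t = integral square (\<lambda>z. u (P t z) * bump z)" for t
  define J' where "J' t = integral square (\<lambda>z. (ux (P t z) * fst z + uy (P t z) * snd z) * bump z)" for t
  \<comment> \<open>Differentiation under the integral sign; the chain rule along
    \<open>\<lambda>t. P t z\<close> gives the inner product of the gradient with
    \<open>z\<close>.\<close>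
  have JJ': "(J has_vector_derivative J' t) (at t within {0..r})" if "t \<in> {0..r}" for t
    unfolding J_def J'_def
  proof (rule leibniz_rule_vector_derivative)
    fix t z assume t: "t \<in> {0..r}" and z: "z \<in> square"
    have "((\<lambda>t. P t z) has_vector_derivative Complex (fst z) (snd z)) (at t within {0..r})"
      unfolding P_def Complex_eq by (auto intro!: derivative_eq_intros simp: algebra_simps)
    from has_derivative_compose[OF this[unfolded has_vector_derivative_def] du[OF PS[OF t z]]]
    have "((\<lambda>t. u (P t z)) has_vector_derivative ux (P t z) * fst z + uy (P t z) * snd z) (at t within {0..r})"
      unfolding has_vector_derivative_def by (simp add: algebra_simps)
    then show "((\<lambda>t. u (P t z) * bump z) has_vector_derivative
        (ux (P t z) * fst z + uy (P t z) * snd z) * bump z) (at t within {0..r})"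
      by (auto intro!: derivative_eq_intros)
  next
    show "(\<lambda>z. u (P t z) * bump z) integrable_on square" if "t \<in> {0..r}" for t
      by (intro integrable_continuous continuous_intros contcomp contu that)
    show "continuous_on ({0..r} \<times> square) (\<lambda>(t, z). (ux (P t z) * fst z + uy (P t z) * snd z) * bump z)"
      unfolding case_prod_unfold bump_def by (intro continuous_intros contcomp2 contu)
  qed (use that in auto)
  \<comment> \<open>Each of the two terms is integrated by parts in its own variable. The results
    share the factor \<open>t * ((bump z)\<^sup>2 / 4)\<close>, so their sum contains the
    Laplacian.\<close>
  have J'0: "J' t = 0" if t: "t \<in> {0..r}" for t
  proof -
    have x: "integral square (\<lambda>z. ux (P t z) * (fst z * bump z)) =
      integral square (\<lambda>z. t * uxx (P t z) * ((bump z)\<^sup>2 / 4))" (is "?l = ?r")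
    proof -
      have "?l = integral {-1..1} (\<lambda>y. integral {-1..1} (\<lambda>x. ux (P t (x, y)) * (x * max 0 (1 - x\<^sup>2 - y\<^sup>2))))"
        by (subst integral_square_fst) (auto simp: bump_def intro!: continuous_intros contcomp contu t)
      also have "\<dots> = integral {-1..1} (\<lambda>y. integral {-1..1} (\<lambda>x. t * uxx (P t (x, y)) * ((max 0 (1 - x\<^sup>2 - y\<^sup>2))\<^sup>2 / 4)))"
      proof (rule integral_cong, rule integral_by_parts_bump)
        fix y :: real assume y: "y \<in> {-1..1}"
        show "((\<lambda>x. ux (P t (x, y))) has_real_derivative t * uxx (P t (x, y))) (at x)" if x: "x \<in> {-1..1}" for x
        proof -
          have Pd: "((\<lambda>x. P t (x, y)) has_derivative (\<lambda>h. Complex (t * h) 0)) (at x)"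
            unfolding P_def Complex_eq by (auto intro!: derivative_eq_intros)
          have "P t (x, y) \<in> S" using x y t by (intro PS) (auto simp: cbox_Pair_eq)
          from has_derivative_compose[OF Pd dux[OF this]]
          show ?thesis unfolding has_field_derivative_def
            by (rule has_derivative_eq_rhs) (simp add: fun_eq_iff)
        qed
        show "continuous_on {-1..1} (\<lambda>x. t * uxx (P t (x, y)))"
          by (intro continuous_intros continuous_on_compose2[OF contcomp[OF cont(1) t]])
            (use y in \<open>auto simp: cbox_Pair_eq\<close>)
      qed auto
      also have "\<dots> = ?r"
        by (subst integral_square_fst) (auto simp: bump_def intro!: continuous_intros contcomp cont t)
      finally show ?thesis .
    qed
    have y: "integral square (\<lambda>z. uy (P t z) * (snd z * bump z)) =
      integral square (\<lambda>z. t * uyy (P t z) * ((bump z)\<^sup>2 / 4))" (is "?l = ?r")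
    proof -
      \<comment> \<open>Exchanges the roles of the coordinates: now \<open>y\<close> is the variable
        of integration and \<open>x\<^sup>2\<close> the constant \<open>c\<close>.\<close>
      have sw: "1 - x\<^sup>2 - y\<^sup>2 = 1 - y\<^sup>2 - x\<^sup>2" for x y :: real by simp
      have "?l = integral {-1..1} (\<lambda>x. integral {-1..1} (\<lambda>y. uy (P t (x, y)) * (y * max 0 (1 - y\<^sup>2 - x\<^sup>2))))"
        by (subst integral_square_snd) (auto simp: bump_def sw[of "fst _"] sw[of _ "snd _"] intro!: continuous_intros contcomp contu t integral_cong)
      also have "\<dots> = integral {-1..1} (\<lambda>x. integral {-1..1} (\<lambda>y. t * uyy (P t (x, y)) * ((max 0 (1 - y\<^sup>2 - x\<^sup>2))\<^sup>2 / 4)))"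
      proof (rule integral_cong, rule integral_by_parts_bump)
        fix x :: real assume x: "x \<in> {-1..1}"
        show "((\<lambda>y. uy (P t (x, y))) has_real_derivative t * uyy (P t (x, y))) (at y)" if y: "y \<in> {-1..1}" for y
        proof -
          have Pd: "((\<lambda>y. P t (x, y)) has_derivative (\<lambda>h. Complex 0 (t * h))) (at y)"
            unfolding P_def Complex_eq by (auto intro!: derivative_eq_intros)
          have "P t (x, y) \<in> S" using x y t by (intro PS) (auto simp: cbox_Pair_eq)
          from has_derivative_compose[OF Pd duy[OF this]]
          show ?thesis unfolding has_field_derivative_def
            by (rule has_derivative_eq_rhs) (simp add: fun_eq_iff)
        qed
        show "continuous_on {-1..1} (\<lambda>y. t * uyy (P t (x, y)))"
          by (intro continuous_intros continuous_on_compose2[OF contcomp[OF cont(4) t]])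
            (use x in \<open>auto simp: cbox_Pair_eq\<close>)
      qed auto
      also have "\<dots> = ?r"
        by (subst integral_square_snd) (auto simp: bump_def sw[of "fst _"] intro!: continuous_intros contcomp cont t integral_cong)
      finally show ?thesis .
    qed
    have "J' t = integral square (\<lambda>z. ux (P t z) * (fst z * bump z) + uy (P t z) * (snd z * bump z))"
      unfolding J'_def by (simp add: algebra_simps)
    also have "\<dots> = integral square (\<lambda>z. ux (P t z) * (fst z * bump z)) + integral square (\<lambda>z. uy (P t z) * (snd z * bump z))"
      by (intro integral_add integrable_continuous continuous_intros contcomp contu t)
    also have "\<dots> = integral square (\<lambda>z. t * uxx (P t z) * ((bump z)\<^sup>2 / 4) + t * uyy (P t z) * ((bump z)\<^sup>2 / 4))"
      unfolding x y by (intro integral_add[symmetric] integrable_continuous continuous_intros contcomp cont t) auto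
    also have "\<dots> = integral square (\<lambda>z. 0)"
    proof (rule integral_cong)
      fix z assume "z \<in> square"
      with lap[OF PS[OF t this]]
      show "t * uxx (P t z) * ((bump z)\<^sup>2 / 4) + t * uyy (P t z) * ((bump z)\<^sup>2 / 4) = 0"
        by (metis distrib_left distrib_right mult_zero_left mult_zero_right)
    qed
    finally show ?thesis by simp
  qed
  have "(J' has_integral (J r - J 0)) {0..r}"
    by (rule fundamental_theorem_of_calculus) (use JJ' \<open>0 \<le> r\<close> in auto)
  moreover have "(J' has_integral 0) {0..r}"
    by (rule has_integral_is_0) (use J'0 in auto)
  ultimately have "J r - J 0 = 0" by (rule has_integral_unique)
  moreover have "J 0 = u w * integral square bump"
    by (simp add: J_def P_def Complex_eq)
  ultimately have "J r = u w * integral square bump" by simp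
  then show ?thesis by (simp add: J_def P_def)
qed

section \<open>Pointwise bounds by area integrals\<close>

text \<open>Carries area integrals over the complex plane to pairs, where the bump is defined. Both
  measures give a box the product of its side lengths.\<close>

lemma lborel_complex: "lborel = distr (lborel :: (real \<times> real) measure) borel (\<lambda>z. Complex (fst z) (snd z))"
proof (rule lborel_eqI)
  have [measurable]: "(\<lambda>z::real \<times> real. Complex (fst z) (snd z)) \<in> borel_measurable borel"
    unfolding Complex_eq by (intro borel_measurable_continuous_onI continuous_intros)
  fix l u :: complex assume lu: "\<And>b. b \<in> Basis \<Longrightarrow> l \<bullet> b \<le> u \<bullet> b"
  have "(\<lambda>z::real \<times> real. Complex (fst z) (snd z)) -` box l u = box (Re l, Im l) (Re u, Im u)"
    by (auto simp: mem_box Basis_complex_def Basis_prod_def inner_complex_def)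
  then show "emeasure (distr (lborel :: (real \<times> real) measure) borel (\<lambda>z. Complex (fst z) (snd z))) (box l u) =
      (\<Prod>b\<in>Basis. (u - l) \<bullet> b)"
    using lu[of 1] lu[of \<i>]
    by (simp add: emeasure_distr emeasure_lborel_box_eq Basis_complex_def Basis_prod_def inner_complex_def)
qed simp

lemma nn_integral_complex_affine:
  assumes [measurable]: "G \<in> borel_measurable borel" and "0 < r"
  shows "(\<integral>\<^sup>+ z. G z \<partial>lborel) =
    ennreal (r\<^sup>2) * (\<integral>\<^sup>+ z. G (w + Complex (r * fst z) (r * snd z)) \<partial>(lborel :: (real \<times> real) measure))"
proof -
  have [measurable]: "(\<lambda>z::real \<times> real. Complex (fst z) (snd z)) \<in> borel_measurable borel"
    unfolding Complex_eq by (intro borel_measurable_continuous_onI continuous_intros)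
  have "(\<integral>\<^sup>+ z. G z \<partial>lborel) = ennreal (r\<^sup>2) * (\<integral>\<^sup>+ z. G (w + r *\<^sub>R z) \<partial>lborel)"
    using \<open>0 < r\<close> by (subst lborel_affine[of r w])
      (simp_all add: nn_integral_density nn_integral_distr nn_integral_cmult)
  also have "(\<integral>\<^sup>+ z. G (w + r *\<^sub>R z) \<partial>lborel) =
      (\<integral>\<^sup>+ z. G (w + r *\<^sub>R Complex (fst z) (snd z)) \<partial>(lborel :: (real \<times> real) measure))"
    by (subst lborel_complex) (simp add: nn_integral_distr)
  finally show ?thesis by (simp add: Complex_eq scaleR_conv_of_real algebra_simps)
qed

lemma complex_harmonic_on_imp_continuous_on:
  assumes "complex_harmonic_on S f"
  shows "continuous_on S f"
proof -
  have "continuous_on S u" if u: "harmonic_on S u" for u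
  proof -
    obtain ux uy where "\<forall>z\<in>S. (u has_derivative (\<lambda>h. ux z * Re h + uy z * Im h)) (at z)"
      using u unfolding harmonic_on_def by fast
    then have "\<And>z. z \<in> S \<Longrightarrow> (u has_derivative (\<lambda>h. ux z * Re h + uy z * Im h)) (at z)" by blast
    then show ?thesis by (intro has_derivative_continuous_on) (rule has_derivative_at_withinI)
  qed
  then have "continuous_on S (\<lambda>z. Complex (Re (f z)) (Im (f z)))"
    using assms unfolding complex_harmonic_on_def by (intro continuous_on_Complex) auto
  then show ?thesis by simp
qed

text \<open>Nothing is known about \<open>f\<close> off \<open>A\<close>, so \<open>f\<close> is cut
  off by the indicator before the power is taken; this does not change the product.\<close>

lemma borel_measurable_powr_indicator:
  fixes f :: "complex \<Rightarrow> complex"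
  assumes "continuous_on A f" and [measurable]: "A \<in> sets borel"
  shows "(\<lambda>z. ennreal (cmod (f z) powr p) * indicator A z) \<in> borel_measurable borel"
proof -
  have [measurable]: "(\<lambda>z. indicator A z *\<^sub>R f z) \<in> borel_measurable borel"
    by (rule borel_measurable_continuous_on_indicator) fact+
  have "(\<lambda>z. ennreal (cmod (indicator A z *\<^sub>R f z) powr p) * indicator A z) \<in> borel_measurable borel"
    by measurable
  then show ?thesis by (rule measurable_cong[THEN iffD1, rotated]) (auto simp: indicator_def)
qed

text \<open>The divisor is 2 * 4: a factor 2 for adding the bounds of real and imaginary part, and a
  factor 4 for squaring half the radius.\<close>

definition mean_const :: real where
  "mean_const = integral square bump / 8"

lemma mean_const_pos: "0 < mean_const"
  using integral_bump_pos by (simp add: mean_const_def)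

text \<open>The weighted mean value identity, applied to real and imaginary part separately, with
  the bump estimated by 1.\<close>

lemma harmonic_L1_bound:
  assumes f: "complex_harmonic_on S f" and R: "0 < R" and sub: "cball w R \<subseteq> S"
  shows "ennreal (mean_const * R\<^sup>2 * cmod (f w)) \<le>
    (\<integral>\<^sup>+ z. ennreal (cmod (f z)) * indicator (cball w R) z \<partial>lborel)"
proof -
  let ?c = "integral square bump"
  \<comment> \<open>With half the radius the whole square about \<open>w\<close> stays in the disc,
    by the estimate of the modulus by the sum of the absolute coordinates.\<close>
  define r where "r = R / 2"
  have r: "0 < r" using R by (simp add: r_def)
  define P where "P z = w + Complex (r * fst z) (r * snd z)" for z :: "real \<times> real"
  have in_cball: "w + Complex x y \<in> cball w R" if "\<bar>x\<bar> \<le> r" "\<bar>y\<bar> \<le> r" for x y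
    using that cmod_le[of "Complex x y"] by (simp add: dist_norm r_def)
  have P: "P z \<in> cball w R" if "z \<in> square" for z
    unfolding P_def using that r
    by (intro in_cball) (cases z; auto simp: cbox_Pair_eq abs_mult intro!: mult_left_le)+
  have contf: "continuous_on (cball w R) f"
    using complex_harmonic_on_imp_continuous_on[OF f] sub continuous_on_subset by blast
  have contP: "continuous_on square (\<lambda>z. f (P z))"
    by (rule continuous_on_compose2[OF contf]) (use P in \<open>auto simp: P_def Complex_eq intro!: continuous_intros\<close>)
  define I where "I = integral square (\<lambda>z. cmod (f (P z)))"
  have int: "(\<lambda>z. cmod (f (P z))) integrable_on square"
    by (intro integrable_continuous continuous_intros contP)
  have part: "\<bar>u w\<bar> * ?c \<le> I"
    if u: "harmonic_on S u" "continuous_on square (\<lambda>z. u (P z))" "\<And>z. \<bar>u z\<bar> \<le> cmod (f z)" for u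
  proof -
    have "u w * ?c = integral square (\<lambda>z. u (P z) * bump z)"
      unfolding P_def by (rule harmonic_on_bump_mean[symmetric, OF u(1)]) (use r in_cball sub in auto)
    moreover have "norm (integral square (\<lambda>z. u (P z) * bump z)) \<le> I"
      unfolding I_def
    proof (rule integral_norm_bound_integral)
      show "(\<lambda>z. u (P z) * bump z) integrable_on square"
        by (intro integrable_continuous continuous_intros u(2))
      fix z
      have "\<bar>bump z\<bar> \<le> 1" by (auto simp: bump_def)
      then show "norm (u (P z) * bump z) \<le> cmod (f (P z))"
        using mult_mono[OF u(3)[of "P z"], of "\<bar>bump z\<bar>" 1] by (simp add: abs_mult)
    qed (rule int)
    ultimately show ?thesis using integral_bump_pos by (metis abs_mult abs_of_pos real_norm_def)
  qed
  have "\<bar>Re (f w)\<bar> * ?c \<le> I" "\<bar>Im (f w)\<bar> * ?c \<le> I"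
    by (rule part; use f in \<open>auto simp: complex_harmonic_on_def abs_Re_le_cmod abs_Im_le_cmod intro!: continuous_intros contP\<close>)+
  moreover have "cmod (f w) * ?c \<le> (\<bar>Re (f w)\<bar> + \<bar>Im (f w)\<bar>) * ?c"
    using integral_bump_pos by (intro mult_right_mono cmod_le) auto
  ultimately have le: "cmod (f w) * ?c \<le> 2 * I" by (simp add: distrib_right)
  define G where "G z = ennreal (cmod (f z)) * indicator (cball w R) z" for z
  have G: "G \<in> borel_measurable borel"
    using borel_measurable_powr_indicator[OF contf, of 1] unfolding G_def by simp
  \<comment> \<open>The gauge integral of a nonnegative function becomes a Lebesgue integral; the
    square is mapped into the disc, and the change of variables contributes
    \<open>r\<^sup>2\<close>.\<close>
  have "ennreal I = (\<integral>\<^sup>+ z. ennreal (cmod (f (P z))) * indicator square z \<partial>lborel)"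
    by (rule nn_integral_has_integral_lebesgue'[symmetric]) (use int in \<open>auto simp: I_def integrable_integral\<close>)
  also have "\<dots> \<le> (\<integral>\<^sup>+ z. G (P z) \<partial>lborel)"
    by (intro nn_integral_mono) (use P in \<open>auto simp: G_def indicator_def\<close>)
  finally have le2: "ennreal (r\<^sup>2) * ennreal I \<le> (\<integral>\<^sup>+ z. G z \<partial>lborel)"
    unfolding nn_integral_complex_affine[OF G r, of w] P_def by (rule mult_left_mono) simp
  have "mean_const * R\<^sup>2 * cmod (f w) \<le> r\<^sup>2 * I"
    using mult_left_mono[OF le, of "R\<^sup>2 / 8"] by (simp add: mean_const_def r_def power_divide algebra_simps)
  then have "ennreal (mean_const * R\<^sup>2 * cmod (f w)) \<le> ennreal (r\<^sup>2) * ennreal I"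
    by (simp add: ennreal_leI flip: ennreal_mult')
  also note le2
  finally show ?thesis unfolding G_def .
qed

text \<open>Common to both ranges of \<open>p\<close>: a pointwise bound of
  \<open>\<bar>f\<bar>\<close> that is affine in \<open>\<bar>f\<bar>\<^sup>p\<close> is inserted
  into the estimate for exponent 1. The term \<open>pi * R\<^sup>2\<close> is the area of the
  disc.\<close>

lemma harmonic_bound_via_powr:
  assumes f: "complex_harmonic_on S f" and R: "0 < R" "cball w R \<subseteq> S"
    and nonneg: "0 \<le> \<rho>" "0 \<le> \<mu>" "0 \<le> i"
    and le: "\<And>z. z \<in> cball w R \<Longrightarrow> cmod (f z) \<le> \<rho> + \<mu> * cmod (f z) powr p"
    and i: "(\<integral>\<^sup>+ z. ennreal (cmod (f z) powr p) * indicator (cball w R) z \<partial>lborel) \<le> ennreal i"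
  shows "mean_const * R\<^sup>2 * cmod (f w) \<le> pi * R\<^sup>2 * \<rho> + \<mu> * i"
proof -
  have contf: "continuous_on (cball w R) f"
    using complex_harmonic_on_imp_continuous_on[OF f] R continuous_on_subset by blast
  have meas: "(\<lambda>z. ennreal (cmod (f z) powr p) * indicator (cball w R) z) \<in> borel_measurable lborel"
    using borel_measurable_powr_indicator[OF contf, of p] by simp
  have "ennreal (mean_const * R\<^sup>2 * cmod (f w)) \<le> (\<integral>\<^sup>+ z. ennreal (cmod (f z)) * indicator (cball w R) z \<partial>lborel)"
    by (rule harmonic_L1_bound) fact+
  also have "\<dots> \<le> (\<integral>\<^sup>+ z. ennreal \<rho> * indicator (cball w R) z +
      ennreal \<mu> * (ennreal (cmod (f z) powr p) * indicator (cball w R) z) \<partial>lborel)"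
    by (intro nn_integral_mono)
      (use le nonneg in \<open>auto simp: indicator_def intro!: ennreal_leI simp flip: ennreal_mult ennreal_plus\<close>)
  also have "\<dots> = ennreal \<rho> * ennreal (pi * R\<^sup>2) +
      ennreal \<mu> * (\<integral>\<^sup>+ z. ennreal (cmod (f z) powr p) * indicator (cball w R) z \<partial>lborel)"
  proof (subst nn_integral_add)
    show "(\<lambda>z. ennreal \<mu> * (ennreal (cmod (f z) powr p) * indicator (cball w R) z)) \<in> borel_measurable lborel"
      by (intro borel_measurable_times_ennreal meas) simp
    show "(\<lambda>z. ennreal \<rho> * indicator (cball w R) z) \<in> borel_measurable lborel"
      by (intro borel_measurable_times_ennreal borel_measurable_indicator) auto
  qed (use R(1) in \<open>simp_all add: nn_integral_cmult[OF meas] nn_integral_cmult_indicator emeasure_cball unit_ball_vol_2\<close>)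
  also have "\<dots> \<le> ennreal \<rho> * ennreal (pi * R\<^sup>2) + ennreal \<mu> * ennreal i"
    by (intro add_left_mono mult_left_mono i) simp
  also have "\<dots> = ennreal (pi * R\<^sup>2 * \<rho> + \<mu> * i)"
    using nonneg by (simp add: ennreal_mult ennreal_plus mult.commute)
  finally show ?thesis
    using nonneg by (subst (asm) ennreal_le_iff) auto
qed

text \<open>Instead of Jensen's inequality, \<open>t\<close> is bounded by a threshold
  \<open>\<rho>\<close> plus a multiple of its \<open>p\<close>-th power. A threshold proportional
  to \<open>\<bar>f w\<bar>\<close> can be absorbed into the left-hand side.\<close>

lemma harmonic_powr_bound_ge_1:
  assumes "1 \<le> p"
  obtains \<kappa> where "0 < \<kappa>" "\<And>S f w R i. complex_harmonic_on S f \<Longrightarrow> 0 < R \<Longrightarrow> cball w R \<subseteq> S \<Longrightarrow> 0 \<le> i \<Longrightarrow>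
    (\<integral>\<^sup>+ z. ennreal (cmod (f z) powr p) * indicator (cball w R) z \<partial>lborel) \<le> ennreal i \<Longrightarrow>
    \<kappa> * R\<^sup>2 * cmod (f w) powr p \<le> i"
proof -
  \<comment> \<open>Chosen so that the threshold term is exactly half of the left-hand side.\<close>
  define \<theta> where "\<theta> = mean_const / (2 * pi)"
  have \<theta>: "\<theta> > 0" using mean_const_pos by (simp add: \<theta>_def)
  show thesis
  proof (rule that[of "mean_const / 2 * \<theta> powr (p - 1)"])
    show "0 < mean_const / 2 * \<theta> powr (p - 1)" using mean_const_pos \<theta> by simp
    fix S f w and R i :: real
    assume f: "complex_harmonic_on S f" "0 < R" "cball w R \<subseteq> S" "0 \<le> i"
      "(\<integral>\<^sup>+ z. ennreal (cmod (f z) powr p) * indicator (cball w R) z \<partial>lborel) \<le> ennreal i"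
    define a where "a = cmod (f w)"
    show "mean_const / 2 * \<theta> powr (p - 1) * R\<^sup>2 * cmod (f w) powr p \<le> i"
    proof (cases "a = 0")
      case True then show ?thesis using f(4) by (simp add: a_def)
    next
      case False
      then have a: "a > 0" by (simp add: a_def)
      define \<rho> where "\<rho> = \<theta> * a"
      have \<rho>: "\<rho> > 0" using \<theta> a by (simp add: \<rho>_def)
      \<comment> \<open>Up to \<open>\<rho>\<close> the first term suffices; beyond it the second
        does, as \<open>1 - p\<close> is not positive and so \<open>t powr (1 - p)\<close> does not
        exceed \<open>\<rho> powr (1 - p)\<close>.\<close>
      have le: "t \<le> \<rho> + \<rho> powr (1 - p) * t powr p" if "t \<ge> 0" for t
      proof (cases "t \<le> \<rho>")
        case True
        have "0 \<le> \<rho> powr (1 - p) * t powr p" by simp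
        with True show ?thesis by linarith
      next
        case False
        then have t: "0 < t" "\<rho> < t" using \<rho> by linarith+
        have "t = t powr (1 - p) * t powr p" using t by (simp flip: powr_add)
        also have "\<dots> \<le> \<rho> powr (1 - p) * t powr p"
          using t \<rho> assms by (intro mult_right_mono powr_mono2') auto
        finally show ?thesis using \<rho> by linarith
      qed
      have "mean_const * R\<^sup>2 * a \<le> pi * R\<^sup>2 * \<rho> + \<rho> powr (1 - p) * i"
        unfolding a_def by (rule harmonic_bound_via_powr[OF f(1,2,3) _ _ f(4) _ f(5)]) (use \<rho> le in auto)
      moreover have "pi * R\<^sup>2 * \<rho> = mean_const * R\<^sup>2 * a / 2" by (simp add: \<rho>_def \<theta>_def)
      ultimately have "mean_const * R\<^sup>2 * a / 2 \<le> \<rho> powr (1 - p) * i" by linarith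
      then have "mean_const / 2 * R\<^sup>2 * a \<le> \<rho> powr (1 - p) * i" by simp
      \<comment> \<open>This factor isolates \<open>i\<close> on the right and, as
        \<open>\<rho> = \<theta> * a\<close>, supplies the missing power \<open>p - 1\<close> of
        \<open>a\<close> on the left.\<close>
      then have "\<rho> powr (p - 1) * (mean_const / 2 * R\<^sup>2 * a) \<le> \<rho> powr (p - 1) * (\<rho> powr (1 - p) * i)"
        by (intro mult_left_mono) auto
      also have "\<dots> = i" using \<rho> by (simp flip: mult.assoc powr_add)
      also have "\<rho> powr (p - 1) * (mean_const / 2 * R\<^sup>2 * a) = mean_const / 2 * \<theta> powr (p - 1) * R\<^sup>2 * (a powr (p - 1) * a powr 1)"
        using \<theta> a by (simp add: \<rho>_def powr_mult)
      also have "a powr (p - 1) * a powr 1 = a powr p"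
        using powr_add[of a "p - 1" 1] by simp
      finally show ?thesis by (simp add: a_def)
    qed
  qed
qed

text \<open>Hardy and Littlewood's trick: at a maximum \<open>w'\<close> of \<open>\<bar>f\<bar>\<^sup>p\<close> weighted by the squared distance to
  the boundary of the disc, \<open>\<bar>f\<bar>\<close> is at most a constant times \<open>\<bar>f w'\<bar>\<close> near \<open>w'\<close>.\<close>

lemma harmonic_powr_bound_less_1:
  assumes "0 < p" "p < 1"
  obtains \<kappa> where "0 < \<kappa>" "\<And>S f w R i. complex_harmonic_on S f \<Longrightarrow> 0 < R \<Longrightarrow> cball w R \<subseteq> S \<Longrightarrow> 0 \<le> i \<Longrightarrow>
    (\<integral>\<^sup>+ z. ennreal (cmod (f z) powr p) * indicator (cball w R) z \<partial>lborel) \<le> ennreal i \<Longrightarrow>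
    \<kappa> * R\<^sup>2 * cmod (f w) powr p \<le> i"
proof -
  \<comment> \<open>The \<open>p\<close>-th power of \<open>c\<close> is 4, which makes up for
    halving the squared distance to the boundary.\<close>
  define c :: real where "c = 4 powr (1 / p)"
  have c: "c > 0" "c powr p = 4" using assms by (auto simp: c_def powr_powr)
  show thesis
  proof (rule that[of "mean_const / 4 * c powr (p - 1)"])
    show "0 < mean_const / 4 * c powr (p - 1)" using mean_const_pos c by simp
    fix S f w and R i :: real
    assume f: "complex_harmonic_on S f" "0 < R" "cball w R \<subseteq> S" "0 \<le> i"
      "(\<integral>\<^sup>+ z. ennreal (cmod (f z) powr p) * indicator (cball w R) z \<partial>lborel) \<le> ennreal i"
    have contf: "continuous_on (cball w R) f"
      using complex_harmonic_on_imp_continuous_on[OF f(1)] f(3) continuous_on_subset by blast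
    \<comment> \<open>The weight vanishes on the bounding circle, so a positive maximum is attained
      in the open disc.\<close>
    define \<Phi> where "\<Phi> z = cmod (f z) powr p * (R - dist w z)\<^sup>2" for z
    have "continuous_on (cball w R) \<Phi>"
      unfolding \<Phi>_def using assms by (intro continuous_intros contf continuous_on_powr') auto
    then obtain w' where w': "w' \<in> cball w R" "\<And>z. z \<in> cball w R \<Longrightarrow> \<Phi> z \<le> \<Phi> w'"
      using continuous_attains_sup[of "cball w R" \<Phi>] f(2) by auto
    have \<Phi>w: "cmod (f w) powr p * R\<^sup>2 \<le> \<Phi> w'"
      using w'(2)[of w] f(2) by (simp add: \<Phi>_def)
    show "mean_const / 4 * c powr (p - 1) * R\<^sup>2 * cmod (f w) powr p \<le> i"
    proof (cases "\<Phi> w' = 0")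
      case True
      then have "cmod (f w) powr p * R\<^sup>2 = 0" using \<Phi>w by (metis antisym mult_nonneg_nonneg powr_ge_zero zero_le_power2)
      then show ?thesis using f(4) by auto
    next
      case False
      define b where "b = cmod (f w')"
      define d where "d = R - dist w w'"
      have bd: "b > 0" "d > 0" using False w'(1) by (auto simp: \<Phi>_def b_def d_def)
      have sub: "cball w' (d / 2) \<subseteq> cball w R"
        using bd(2) by (simp add: cball_subset_cball_iff d_def dist_commute field_simps)
      \<comment> \<open>Points of the half-size disc keep at least half the distance
        \<open>d\<close>, so maximality gives \<open>\<bar>f z\<bar> \<le> c * b\<close> there.
        Splitting \<open>\<bar>f z\<bar>\<close> into powers \<open>1 - p\<close> and
        \<open>p\<close> then gives the required bound with threshold 0.\<close>
      have le: "cmod (f z) \<le> 0 + (c * b) powr (1 - p) * cmod (f z) powr p" if z: "z \<in> cball w' (d / 2)" for z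
      proof (cases "f z = 0")
        case False
        have "d / 2 \<le> R - dist w z"
          using z dist_triangle[of w z w'] by (simp add: d_def)
        then have "cmod (f z) powr p * (d / 2)\<^sup>2 \<le> \<Phi> z"
          unfolding \<Phi>_def using bd by (intro mult_left_mono power_mono) auto
        also have "\<dots> \<le> b powr p * d\<^sup>2"
          using w'(2)[of z] z sub by (auto simp: \<Phi>_def b_def d_def)
        finally have "cmod (f z) powr p \<le> (c * b) powr p"
          using bd c by (simp add: powr_mult power_divide field_simps)
        then have "cmod (f z) \<le> c * b"
          using powr_less_mono2[of p "c * b" "cmod (f z)"] assms c bd by force
        have "cmod (f z) = cmod (f z) powr (1 - p) * cmod (f z) powr p"
          using False by (simp flip: powr_add)
        also have "\<dots> \<le> (c * b) powr (1 - p) * cmod (f z) powr p"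
          using \<open>cmod (f z) \<le> c * b\<close> assms by (intro mult_right_mono powr_mono2) auto
        finally show ?thesis by simp
      qed simp
      have "(\<integral>\<^sup>+ z. ennreal (cmod (f z) powr p) * indicator (cball w' (d / 2)) z \<partial>lborel) \<le>
        (\<integral>\<^sup>+ z. ennreal (cmod (f z) powr p) * indicator (cball w R) z \<partial>lborel)"
        by (intro nn_integral_mono mult_left_mono) (use sub in \<open>auto simp: indicator_def\<close>)
      also note f(5)
      finally have "mean_const * (d / 2)\<^sup>2 * b \<le> pi * (d / 2)\<^sup>2 * 0 + (c * b) powr (1 - p) * i"
        unfolding b_def
        by (intro harmonic_bound_via_powr[OF f(1), where p=p]) (use bd sub f(3,4) le in \<open>auto simp: b_def\<close>)
      then have "mean_const / 4 * d\<^sup>2 * b \<le> (c * b) powr (1 - p) * i" by (simp add: power_divide)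
      then have "(c * b) powr (p - 1) * (mean_const / 4 * d\<^sup>2 * b) \<le> (c * b) powr (p - 1) * ((c * b) powr (1 - p) * i)"
        by (intro mult_left_mono) auto
      also have "\<dots> = i" using bd c by (simp flip: mult.assoc powr_add)
      also have "(c * b) powr (p - 1) * (mean_const / 4 * d\<^sup>2 * b) = mean_const / 4 * c powr (p - 1) * d\<^sup>2 * (b powr (p - 1) * b powr 1)"
        using c bd by (simp add: powr_mult)
      also have "b powr (p - 1) * b powr 1 = b powr p"
        using powr_add[of b "p - 1" 1] by simp
      \<comment> \<open>The estimate at the maximum point passes to \<open>w\<close>, because
        \<open>\<Phi> w'\<close> dominates \<open>\<Phi> w\<close>, in which the distance is the
        full radius \<open>R\<close>.\<close>
      finally have "mean_const / 4 * c powr (p - 1) * \<Phi> w' \<le> i" by (simp add: \<Phi>_def b_def d_def algebra_simps)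
      moreover have "mean_const / 4 * c powr (p - 1) * (cmod (f w) powr p * R\<^sup>2) \<le> mean_const / 4 * c powr (p - 1) * \<Phi> w'"
        using \<Phi>w mean_const_pos by (intro mult_left_mono) auto
      ultimately show ?thesis by (simp add: algebra_simps)
    qed
  qed
qed

section \<open>Length of convex curves\<close>

text \<open>For \<open>F\<close> that is not monotone and right continuous, \<open>interval_measure F\<close> may be the zero measure;
  hence only an inequality.\<close>

lemma emeasure_interval_measure_Ioc_le:
  assumes "a \<le> b"
  shows "emeasure (interval_measure F) {a<..b} \<le> ennreal (F b - F a)"
proof -
  define I G \<mu> where "I = {(a :: real, b). a \<le> b}" and "G = (\<lambda>(a :: real, b). {a<..b})"
    and "\<mu> = (\<lambda>(a, b). ennreal (F b - F a))"
  define P where "P \<mu>' \<longleftrightarrow> (\<forall>i\<in>I. \<mu>' (G i) = \<mu> i) \<and> measure_space UNIV (sigma_sets UNIV (G ` I)) \<mu>'" for \<mu>'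
  have IM: "interval_measure F = extend_measure UNIV I G \<mu>"
    by (simp add: interval_measure_def I_def G_def \<mu>_def)
  have i: "(a, b) \<in> I" "G (a, b) = {a<..b}" "\<mu> (a, b) = ennreal (F b - F a)"
    using assms by (auto simp: I_def G_def \<mu>_def)
  \<comment> \<open>\<open>extend_measure\<close> chooses some extension if one exists and the
    prescribed values are not all 0; otherwise it is the zero measure. The first case gives
    equality, the second a left-hand side of 0.\<close>
  show ?thesis
  proof (cases "Ex P \<and> \<not> (\<forall>i\<in>I. \<mu> i = 0)")
    case True
    then have "P (Eps P)" by (intro someI_ex[of P]) simp
    moreover have "interval_measure F = measure_of UNIV (G ` I) (Eps P)"
      using True unfolding IM extend_measure_def P_def by auto
    ultimately show ?thesis
      unfolding i(2)[symmetric] i(3)[symmetric] using i(1)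
      by (auto simp: emeasure_measure_of_conv P_def)
  next
    case False
    then have "interval_measure F = measure_of UNIV (G ` I) (\<lambda>_. 0)"
      unfolding IM extend_measure_def P_def by auto
    then show ?thesis by (simp add: emeasure_measure_of_conv)
  qed
qed

text \<open>Of two frontier points on the same side of \<open>w\<close>, the nearer would lie on the
  open segment from an interior point to a point of the closure, hence in the interior.\<close>

lemma frontier_convex_line_inj:
  fixes U :: "complex set"
  assumes U: "open U" "convex U" and v: "v \<in> Basis" and w: "w \<in> U"
    and z: "z1 \<in> frontier U" "z2 \<in> frontier U" "z1 \<bullet> v = w \<bullet> v" "z2 \<bullet> v = w \<bullet> v"
    and sgn: "sgn ((z1 - w) \<bullet> (\<i> * v)) = sgn ((z2 - w) \<bullet> (\<i> * v))"
  shows "z1 = z2"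
proof -
  \<comment> \<open>The signed position on the line relative to \<open>w\<close>;
    \<open>\<i> * v\<close> is \<open>v\<close> turned by a right angle.\<close>
  define \<sigma> where "\<sigma> z = (z - w) \<bullet> (\<i> * v)" for z
  have eq0: "d = 0" if "d \<bullet> v = 0" "d \<bullet> (\<i> * v) = 0" for d
    using that v by (auto simp: Basis_complex_def inner_complex_def complex_eq_iff)
  have fr: "z \<in> closure U" "z \<notin> U" if "z \<in> frontier U" for z
    using that U(1) by (auto simp: frontier_def interior_open)
  have nz: "\<sigma> z \<noteq> 0" if "z \<in> frontier U" "z \<bullet> v = w \<bullet> v" for z
    using eq0[of "z - w"] that fr[of z] w by (auto simp: \<sigma>_def inner_diff_left)
  have no: "\<not> \<bar>\<sigma> z\<bar> < \<bar>\<sigma> z'\<bar>" if z: "z \<in> frontier U" "z' \<in> frontier U" "z \<bullet> v = w \<bullet> v" "z' \<bullet> v = w \<bullet> v"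
    and sgn: "sgn (\<sigma> z) = sgn (\<sigma> z')" for z z'
  proof
    assume lt: "\<bar>\<sigma> z\<bar> < \<bar>\<sigma> z'\<bar>"
    define k where "k = \<sigma> z / \<sigma> z'"
    have k: "0 < k" "k < 1"
      using lt sgn nz[OF z(1,3)] nz[OF z(2,4)]
      by (auto simp: k_def sgn_if divide_simps split: if_splits)
    have "(z - w) - k *\<^sub>R (z' - w) = 0"
    proof (rule eq0)
      show "((z - w) - k *\<^sub>R (z' - w)) \<bullet> v = 0"
        using z(3,4) by (simp add: inner_diff_left)
      have "((z - w) - k *\<^sub>R (z' - w)) \<bullet> (\<i> * v) = \<sigma> z - k * \<sigma> z'"
        by (simp add: \<sigma>_def inner_diff_left)
      then show "((z - w) - k *\<^sub>R (z' - w)) \<bullet> (\<i> * v) = 0"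
        using nz[OF z(2,4)] by (simp add: k_def)
    qed
    then have "z = (1 - k) *\<^sub>R w + k *\<^sub>R z'" by (simp add: algebra_simps)
    then have "z \<in> open_segment w z'"
      using k fr(2)[OF z(2)] w by (auto simp: in_segment)
    then have "z \<in> U"
      using in_interior_closure_convex_segment[OF U(2), of w z'] U(1) w fr(1)[OF z(2)]
      by (auto simp: interior_open)
    then show False using fr(2)[OF z(1)] by blast
  qed
  have s: "sgn (\<sigma> z1) = sgn (\<sigma> z2)" using sgn by (simp add: \<sigma>_def)
  then have "\<bar>\<sigma> z1\<bar> = \<bar>\<sigma> z2\<bar>"
    using no[OF z(1,2,3,4)] no[OF z(2,1,4,3)] by simp
  with s have "\<sigma> z1 = \<sigma> z2" by (metis sgn_mult_abs)
  then show ?thesis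
    using eq0[of "z1 - z2"] z(3,4) by (simp add: \<sigma>_def inner_diff_left)
qed

text \<open>If the line meets \<open>U\<close>, the sign of the position relative to a point of
  \<open>U\<close> embeds its frontier points into two values. The excluded levels belong to the
  supporting lines, which may contain a whole boundary segment.\<close>

lemma card_frontier_convex_line:
  fixes U :: "complex set"
  assumes U: "open U" "convex U" "bounded U" and v: "v \<in> Basis"
    and c: "c \<notin> {Inf ((\<lambda>z. z \<bullet> v) ` U), Sup ((\<lambda>z. z \<bullet> v) ` U)}"
  shows "finite {z \<in> frontier U. z \<bullet> v = c} \<and> card {z \<in> frontier U. z \<bullet> v = c} \<le> 2"
proof (cases "\<exists>w\<in>U. w \<bullet> v = c")
  case True
  then obtain w where w: "w \<in> U" "w \<bullet> v = c" by blast
  let ?A = "{z \<in> frontier U. z \<bullet> v = c}"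
  let ?s = "\<lambda>z. sgn ((z - w) \<bullet> (\<i> * v))"
  have inj: "inj_on ?s ?A"
    by (rule inj_onI) (use frontier_convex_line_inj[OF U(1,2) v w(1)] w(2) in auto)
  have nz: "?s z \<noteq> 0" if "z \<in> ?A" for z
  proof
    assume "?s z = 0"
    then have "(z - w) \<bullet> (\<i> * v) = 0" by (simp add: sgn_0_0)
    moreover have "(z - w) \<bullet> v = 0" using that w(2) by (simp add: inner_diff_left)
    ultimately have "z = w"
      using v by (auto simp: Basis_complex_def inner_complex_def complex_eq_iff)
    then show False using that w(1) U(1) by (auto simp: frontier_def interior_open)
  qed
  have sub: "?s ` ?A \<subseteq> {-1, 1}"
  proof (rule image_subsetI)
    fix z assume "z \<in> ?A"
    from nz[OF this] show "?s z \<in> {-1, 1}" by (simp add: sgn_if split: if_splits)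
  qed
  have "finite ?A" using inj_on_finite[OF inj sub] by simp
  moreover have "card ?A \<le> 2" using card_inj_on_le[OF inj sub] by simp
  ultimately show ?thesis by blast
next
  case False
  let ?X = "(\<lambda>z. z \<bullet> v) ` U"
  have "z \<bullet> v \<noteq> c" if z: "z \<in> frontier U" for z
  proof
    assume zc: "z \<bullet> v = c"
    have bdd: "bdd_above ?X" "bdd_below ?X"
      using bounded_linear_image[OF U(3) bounded_linear_inner_left, of v]
      by (simp_all add: bounded_imp_bdd_above bounded_imp_bdd_below)
    have "z \<in> closure U" using z by (simp add: frontier_def)
    moreover have "(\<lambda>z. z \<bullet> v) ` closure U \<subseteq> closure ?X"
      by (rule image_closure_subset) (auto intro!: continuous_intros closure_subset)
    ultimately have "c \<in> closure ?X" using zc by blast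
    have "U \<noteq> {}" using \<open>z \<in> closure U\<close> by auto
    \<comment> \<open>Since \<open>c\<close> is neither end of this interval, it lies strictly
      between two attained values, and connectedness makes \<open>c\<close> itself attained: a
      contradiction.\<close>
    have "closure ?X \<subseteq> {Inf ?X..Sup ?X}"
      by (rule closure_minimal) (auto intro!: cInf_lower cSup_upper bdd)
    then have "Inf ?X < c" "c < Sup ?X"
      using \<open>c \<in> closure ?X\<close> c by fastforce+
    then obtain x y where "x \<in> ?X" "x < c" "y \<in> ?X" "c < y"
      using cInf_less_iff[of ?X c] less_cSup_iff[of ?X c] bdd \<open>U \<noteq> {}\<close> by blast
    moreover have "connected ?X"
      by (intro connected_continuous_image continuous_intros convex_connected U(2))
    ultimately have "c \<in> ?X" by (meson connected_contains_Icc atLeastAtMost_iff less_imp_le subsetD)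
    then show False using False by auto
  qed
  then have "{z \<in> frontier U. z \<bullet> v = c} = {}" by blast
  then show ?thesis by (simp only: finite.emptyI card.empty) simp
qed

text \<open>The left-hand side is the integral over \<open>c\<close> of the number of segments whose
  \<open>\<phi>\<close>-image crosses level \<open>c\<close>, and each crossing contributes its own point of the level set.\<close>

lemma sum_abs_diff_le_crossings:
  fixes \<phi> :: "real \<Rightarrow> real"
  assumes cont: "continuous_on {0..1} \<phi>" and bnd: "\<phi> ` {0..1} \<subseteq> {-1..1}" and "finite E"
    and lvl: "\<And>c. c \<notin> E \<Longrightarrow> finite {s \<in> {0<..<1}. \<phi> s = c} \<and> card {s \<in> {0<..<1}. \<phi> s = c} \<le> 2"
    and t: "mono_on {..n} t" "t 0 = 0" "t n = 1"
  shows "(\<Sum>i<n. \<bar>\<phi> (t i) - \<phi> (t (Suc i))\<bar>) \<le> 4"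
proof -
  \<comment> \<open>Open intervals have the same measure as closed ones but omit the values at the
    partition points, so every crossing lies strictly inside its parameter interval.\<close>
  define A where "A i = {min (\<phi> (t i)) (\<phi> (t (Suc i)))<..<max (\<phi> (t i)) (\<phi> (t (Suc i)))}" for i
  have t01: "t i \<in> {0..1}" if "i \<le> n" for i
    using mono_onD[OF t(1), of 0 i] mono_onD[OF t(1), of i n] that t by auto
  have tle: "t i \<le> t j" if "i \<le> j" "j \<le> n" for i j
    using mono_onD[OF t(1), of i j] that by auto
  have A_sets: "A i \<in> sets borel" for i by (simp add: A_def)
  have eA: "emeasure lborel (A i) = ennreal \<bar>\<phi> (t i) - \<phi> (t (Suc i))\<bar>" for i
    by (auto simp: A_def min_def max_def)
  have cross: "\<exists>s\<in>{t i<..<t (Suc i)}. \<phi> s = c" if "i < n" "c \<in> A i" for i c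
  proof -
    have ti: "t i \<le> t (Suc i)" "{t i..t (Suc i)} \<subseteq> {0..1}"
      using tle[of i "Suc i"] t01[of i] t01[of "Suc i"] that by auto
    have conti: "continuous_on {t i..t (Suc i)} \<phi>"
      using cont ti(2) continuous_on_subset by blast
    have "connected (\<phi> ` {t i..t (Suc i)})"
      by (intro connected_continuous_image conti) auto
    moreover have "\<phi> (t i) \<in> \<phi> ` {t i..t (Suc i)}" "\<phi> (t (Suc i)) \<in> \<phi> ` {t i..t (Suc i)}"
      using ti(1) by auto
    ultimately have "c \<in> \<phi> ` {t i..t (Suc i)}"
      using that(2) unfolding A_def connected_iff_interval
      by (auto simp: min_def max_def less_imp_le split: if_splits)
    then obtain s where s: "s \<in> {t i..t (Suc i)}" "\<phi> s = c" by blast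
    moreover have "s \<noteq> t i" "s \<noteq> t (Suc i)" using s(2) that(2) by (auto simp: A_def)
    ultimately show ?thesis by (intro bexI[of _ s]) auto
  qed
  \<comment> \<open>Crossings in different parameter intervals have different parameters, so their
    number is at most the size of the level set; levels outside \<open>{-1..1}\<close> are not
    crossed.\<close>
  have count: "(\<Sum>i<n. indicator (A i) c) \<le> 2 * (indicator {-1..1} c :: ennreal)" if "c \<notin> E" for c
  proof -
    define I where "I = {i. i < n \<and> c \<in> A i}"
    have "\<forall>i\<in>I. \<exists>s. s \<in> {t i<..<t (Suc i)} \<and> \<phi> s = c"
      using cross unfolding I_def by blast
    then obtain s where s: "\<And>i. i \<in> I \<Longrightarrow> s i \<in> {t i<..<t (Suc i)} \<and> \<phi> (s i) = c" by metis
    have inj: "inj_on s I"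
    proof (rule linorder_inj_onI)
      fix i j assume ij: "i < j" "i \<in> I" "j \<in> I"
      then have "s i < t (Suc i)" "t (Suc i) \<le> t j" "t j < s j"
        using s tle[of "Suc i" j] by (auto simp: I_def)
      then show "s i \<noteq> s j" by simp
    qed auto
    have "s ` I \<subseteq> {s \<in> {0<..<1}. \<phi> s = c}"
    proof clarify
      fix i assume i: "i \<in> I"
      then have "0 \<le> t i" "t (Suc i) \<le> 1" using t01[of i] t01[of "Suc i"] by (auto simp: I_def)
      with s[OF i] show "s i \<in> {0<..<1} \<and> \<phi> (s i) = c" by auto
    qed
    then have "card I \<le> 2"
      using card_inj_on_le[OF inj] lvl[OF that] order_trans by blast
    have sumI: "(\<Sum>i<n. indicator (A i) c :: ennreal) = of_nat (card I)"
    proof -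
      have "(\<Sum>i<n. indicator (A i) c :: ennreal) = (\<Sum>i\<in>I. 1)"
        by (rule sum.mono_neutral_cong_right) (auto simp: I_def)
      then show ?thesis by simp
    qed
    show ?thesis
    proof (cases "I = {}")
      case True then show ?thesis using sumI by simp
    next
      case False
      then obtain i where i: "i \<in> I" by blast
      then have "i < n" by (simp add: I_def)
      then have "\<phi> (t i) \<in> {-1..1}" "\<phi> (t (Suc i)) \<in> {-1..1}"
        using bnd t01[of i] t01[of "Suc i"] unfolding image_subset_iff by (simp_all only: Suc_leI less_imp_le)
      then have "c \<in> {-1..1}" using i by (auto simp: I_def A_def min_def max_def split: if_splits)
      moreover have "of_nat (card I) \<le> (2 :: ennreal)"
        using \<open>card I \<le> 2\<close> of_nat_mono[of "card I" 2] by simp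
      ultimately show ?thesis using sumI by simp
    qed
  qed
  have "E \<in> null_sets lborel" using \<open>finite E\<close> by (rule finite_imp_null_set_lborel)
  then have ae: "AE c in lborel. c \<notin> E" by (rule AE_not_in)
  have "ennreal (\<Sum>i<n. \<bar>\<phi> (t i) - \<phi> (t (Suc i))\<bar>) = (\<Sum>i<n. \<integral>\<^sup>+ c. indicator (A i) c \<partial>lborel)"
    by (simp add: eA A_sets)
  also have "\<dots> = (\<integral>\<^sup>+ c. (\<Sum>i<n. indicator (A i) c) \<partial>lborel)"
    by (rule nn_integral_sum[symmetric]) (simp add: borel_measurable_indicator A_sets)
  also have "\<dots> \<le> (\<integral>\<^sup>+ c. 2 * indicator {-1..1::real} c \<partial>lborel)"
  proof (rule nn_integral_mono_AE)
    show "AE c in lborel. (\<Sum>i<n. indicator (A i) c) \<le> 2 * (indicator {-1..1} c :: ennreal)"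
      using ae by eventually_elim (rule count)
  qed
  also have "\<dots> = ennreal 4" by (simp add: nn_integral_cmult)
  finally show ?thesis by (subst (asm) ennreal_le_iff) auto
qed

lemma frontier_inside_convex_curve:
  assumes "simple_closed_param g C"
  shows "open (inside C) \<and> bounded (inside C) \<and> frontier (inside C) = C"
  using Jordan_inside_outside[of g] assms by (auto simp: simple_closed_param_def)

text \<open>The bound must not depend on the parametrization. Each coordinate has variation at most
  4, and the length is at most the sum of the two variations.\<close>

lemma convex_curve_path_length_le:
  assumes C: "convex_curve C" "C \<subseteq> unit_disc" and g: "simple_closed_param g C"
  shows "path_length_between g 0 1 \<le> 8"
proof -
  let ?U = "inside C"
  have U: "open ?U" "convex ?U" "bounded ?U" "frontier ?U = C"
    using frontier_inside_convex_curve[OF g] C(1) by (auto simp: convex_curve_def)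
  have gC: "g ` {0..1} = C" "simple_path g" and contg: "continuous_on {0..1} g"
    using g by (auto simp: simple_closed_param_def path_image_def simple_path_def path_def)
  \<comment> \<open>The ends of the parameter interval have the same image, hence the open
    interval.\<close>
  have inj: "inj_on g {0<..<1}"
    using gC(2) by (force simp: simple_path_def loop_free_def inj_on_def)
  have var: "(\<Sum>i<n. \<bar>g (t i) \<bullet> v - g (t (Suc i)) \<bullet> v\<bar>) \<le> 4"
    if t: "mono_on {..n} t" "t 0 = 0" "t n = 1" and v: "v \<in> Basis" for n t v
  proof (rule sum_abs_diff_le_crossings[OF _ _ _ _ t])
    show "continuous_on {0..1} (\<lambda>s. g s \<bullet> v)" by (intro continuous_intros contg)
    show "(\<lambda>s. g s \<bullet> v) ` {0..1} \<subseteq> {-1..1}"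
    proof clarify
      fix s :: real assume "s \<in> {0..1}"
      then have "g s \<in> unit_disc" using gC(1) C(2) by blast
      then have "norm (g s) < 1" by simp
      then have "\<bar>g s \<bullet> v\<bar> \<le> 1" using Basis_le_norm[OF v, of "g s"] by simp
      then show "g s \<bullet> v \<in> {-1..1}" by auto
    qed
    show "finite {Inf ((\<lambda>z. z \<bullet> v) ` ?U), Sup ((\<lambda>z. z \<bullet> v) ` ?U)}" by simp
    fix c assume c: "c \<notin> {Inf ((\<lambda>z. z \<bullet> v) ` ?U), Sup ((\<lambda>z. z \<bullet> v) ` ?U)}"
    let ?S = "{s \<in> {0<..<1}. g s \<bullet> v = c}" and ?Z = "{z \<in> C. z \<bullet> v = c}"
    have Z: "finite ?Z" "card ?Z \<le> 2"
      using card_frontier_convex_line[OF U(1-3) v c] U(4) by auto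
    have sub: "g ` ?S \<subseteq> ?Z" using gC(1) by (auto simp: image_subset_iff)
    have injS: "inj_on g ?S" using inj by (rule inj_on_subset) auto
    show "finite ?S \<and> card ?S \<le> 2"
      using inj_on_finite[OF injS sub Z(1)] card_inj_on_le[OF injS sub Z(1)] Z(2) by linarith
  qed
  show ?thesis
    unfolding path_length_between_def
  proof (rule Sup_least, clarify)
    fix n :: nat and t :: "nat \<Rightarrow> real"
    assume t: "mono_on {..n} t" "t 0 = 0" "t n = 1"
    have "(\<Sum>i<n. dist (g (t i)) (g (t (Suc i)))) \<le>
      (\<Sum>i<n. \<bar>g (t i) \<bullet> 1 - g (t (Suc i)) \<bullet> 1\<bar> + \<bar>g (t i) \<bullet> \<i> - g (t (Suc i)) \<bullet> \<i>\<bar>)"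
      by (intro sum_mono) (simp add: dist_norm inner_complex_def cmod_le[of "_ - _", simplified])
    also have "\<dots> \<le> 4 + 4"
      unfolding sum.distrib by (intro add_mono var t) (auto simp: Basis_complex_def)
    finally show "ennreal (\<Sum>i<n. dist (g (t i)) (g (t (Suc i)))) \<le> 8"
      by (simp flip: ennreal_numeral)
  qed
qed

lemma arc_length_integral_le:
  assumes len: "path_length_between g 0 1 \<le> 8" and h: "\<And>z. z \<in> path_image g \<Longrightarrow> ennreal (h z) \<le> B"
  shows "arc_length_integral g h \<le> 8 * B"
proof -
  define F where "F t = enn2real (path_length_between g 0 (max 0 (min 1 t)))" for t
  have M: "arc_length_measure g = interval_measure F"
    unfolding arc_length_measure_def F_def ..
  have "F 1 \<le> 8" using enn2real_mono[OF len] by (simp add: F_def)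
  moreover have "0 \<le> F (-1)" by (simp add: F_def)
  ultimately have "F 1 - F (-1) \<le> 8" by simp
  \<comment> \<open>Stieltjes measures are controlled on half-open intervals; starting to the left
    of 0 covers the point 0 as well.\<close>
  have "emeasure (arc_length_measure g) {0..1} \<le> emeasure (arc_length_measure g) {-1<..1}"
    by (rule emeasure_mono) (auto simp: M)
  also have "\<dots> \<le> ennreal (F 1 - F (-1))"
    unfolding M by (rule emeasure_interval_measure_Ioc_le) simp
  also have "\<dots> \<le> 8" using ennreal_leI[OF \<open>F 1 - F (-1) \<le> 8\<close>] by simp
  finally have *: "emeasure (arc_length_measure g) {0..1} \<le> 8" .
  have "arc_length_integral g h \<le> (\<integral>\<^sup>+ t. B * indicator {0..1} t \<partial>arc_length_measure g)"
    unfolding arc_length_integral_def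
    by (intro nn_integral_mono) (auto simp: indicator_def path_image_def intro!: h)
  also have "\<dots> = B * emeasure (arc_length_measure g) {0..1}"
    by (rule nn_integral_cmult_indicator) (simp add: M)
  also have "\<dots> \<le> 8 * B" using mult_left_mono[OF *, of B] by (simp add: mult.commute)
  finally show ?thesis .
qed

section \<open>The estimate on a convex curve\<close>

lemma harmonic_powr_bound:
  assumes "0 < p"
  obtains \<kappa> where "0 < \<kappa>" "\<And>S f w R i. complex_harmonic_on S f \<Longrightarrow> 0 < R \<Longrightarrow> cball w R \<subseteq> S \<Longrightarrow> 0 \<le> i \<Longrightarrow>
    (\<integral>\<^sup>+ z. ennreal (cmod (f z) powr p) * indicator (cball w R) z \<partial>lborel) \<le> ennreal i \<Longrightarrow>
    \<kappa> * R\<^sup>2 * cmod (f w) powr p \<le> i"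
proof (cases "1 \<le> p")
  case True
  then show thesis by (rule harmonic_powr_bound_ge_1) (rule that)
next
  case False
  then have "p < 1" by simp
  with assms show thesis by (rule harmonic_powr_bound_less_1) (rule that)
qed

lemma nn_integral_disc_area:
  assumes "continuous_on unit_disc h"
  shows "(\<integral>\<^sup>+ z. ennreal (h z) \<partial>disc_area) =
    ennreal (1 / pi) * (\<integral>\<^sup>+ z. ennreal (h z) * indicator unit_disc z \<partial>lborel)"
proof -
  have "h \<in> borel_measurable (restrict_space borel unit_disc)"
    by (rule borel_measurable_continuous_on_restrict[OF assms])
  then have meas: "(\<lambda>z. ennreal (h z)) \<in> borel_measurable (restrict_space lborel unit_disc)"
    by (simp cong: measurable_cong_sets sets_restrict_space_cong)
  have "(\<integral>\<^sup>+ z. ennreal (h z) \<partial>disc_area) =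
      ennreal (1 / pi) * (\<integral>\<^sup>+ z. ennreal (h z) \<partial>restrict_space lborel unit_disc)"
    unfolding disc_area_def by (simp add: nn_integral_density nn_integral_cmult meas)
  then show ?thesis by (simp add: nn_integral_restrict_space)
qed

theorem theorem1p2:
  fixes p \<alpha> :: real and C :: "complex set"
  assumes "0 < p" and "-1 < \<alpha>"
    and "convex_curve C" and "C \<subseteq> unit_disc"
  shows "\<exists>K>0. \<forall>f\<in>harmonic_bergman p \<alpha>. \<forall>g. simple_closed_param g C \<longrightarrow>
    arc_length_integral g (\<lambda>z. cmod (f z) powr p * (1 - (cmod z)\<^sup>2) powr (1 + \<alpha>))
      \<le> ennreal K * (\<integral>\<^sup>+ z. ennreal (cmod (f z) powr p * (1 - (cmod z)\<^sup>2) powr \<alpha>) \<partial>disc_area)"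
proof -
  obtain \<kappa> where \<kappa>: "0 < \<kappa>" "\<And>S f w R i. complex_harmonic_on S f \<Longrightarrow> 0 < R \<Longrightarrow> cball w R \<subseteq> S \<Longrightarrow> 0 \<le> i \<Longrightarrow>
    (\<integral>\<^sup>+ z. ennreal (cmod (f z) powr p) * indicator (cball w R) z \<partial>lborel) \<le> ennreal i \<Longrightarrow>
    \<kappa> * R\<^sup>2 * cmod (f w) powr p \<le> i"
    using \<open>0 < p\<close> by (rule harmonic_powr_bound) (rule that)
  obtain g0 where g0: "simple_closed_param g0 C"
    using assms(3) by (auto simp: convex_curve_def)
  then have "compact C" "C \<noteq> {}"
    by (auto simp: simple_closed_param_def compact_simple_path_image)
  then obtain z0 where z0: "z0 \<in> C" "\<And>z. z \<in> C \<Longrightarrow> cmod z \<le> cmod z0"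
    using continuous_attains_sup[of C cmod] by (auto intro: continuous_intros)
  \<comment> \<open>Half of the gap between \<open>C\<close> and the unit circle: discs of radius
    \<open>\<delta>\<close> about points of \<open>C\<close> stay in the disc of radius
    \<open>r < 1\<close>.\<close>
  define r where "r = (1 + cmod z0) / 2"
  define \<delta> where "\<delta> = (1 - cmod z0) / 2"
  have "cmod z0 < 1" using z0(1) assms(4) by auto
  then have r: "0 < r" "r < 1" and \<delta>: "0 < \<delta>" "cmod z0 + \<delta> = r"
    using norm_ge_zero[of z0] unfolding r_def \<delta>_def by (simp_all add: field_simps add_pos_nonneg)
  have sub: "cball z \<delta> \<subseteq> cball 0 r" if "z \<in> C" for z
    using z0(2)[OF that] \<delta> by (simp add: cball_subset_cball_iff)
  \<comment> \<open>A lower bound of the weight on the disc of radius \<open>r\<close> for either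
    sign of \<open>\<alpha>\<close>: the weight is smallest at the edge if \<open>\<alpha>\<close>
    is nonnegative, and at least 1 otherwise.\<close>
  define m where "m = min 1 ((1 - r\<^sup>2) powr \<alpha>)"
  have r2: "0 < 1 - r\<^sup>2" using r by (simp add: power_less_one_iff)
  then have m: "0 < m" by (simp add: m_def)
  have wt: "m \<le> (1 - (cmod z)\<^sup>2) powr \<alpha>" if "cmod z \<le> r" for z
  proof (cases "0 \<le> \<alpha>")
    case True
    have "1 - r\<^sup>2 \<le> 1 - (cmod z)\<^sup>2" using that by (simp add: power_mono)
    then have "(1 - r\<^sup>2) powr \<alpha> \<le> (1 - (cmod z)\<^sup>2) powr \<alpha>" using r2 True by (intro powr_mono2) auto
    then show ?thesis by (simp add: m_def)
  next
    case False
    have "0 < 1 - (cmod z)\<^sup>2" using that r by (simp add: power_less_one_iff)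
    then have "1 powr \<alpha> \<le> (1 - (cmod z)\<^sup>2) powr \<alpha>" using False by (intro powr_mono2') auto
    then show ?thesis by (simp add: m_def)
  qed
  \<comment> \<open>8 bounds the length, \<open>pi\<close> undoes the normalization of area,
    \<open>m\<close> compensates the weight, and the rest comes from the pointwise bound on discs of
    radius \<open>\<delta>\<close>. Neither \<open>f\<close> nor \<open>g\<close> enters.\<close>
  define K where "K = 8 * (pi / (m * (\<kappa> * \<delta>\<^sup>2)))"
  have K: "0 < K" using m \<kappa>(1) \<delta> by (simp add: K_def)
  show ?thesis
  proof (intro exI[of _ K] conjI ballI allI impI K)
    fix f g assume f: "f \<in> harmonic_bergman p \<alpha>" and g: "simple_closed_param g C"
    have harm: "complex_harmonic_on unit_disc f" using f by (simp add: harmonic_bergman_def)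
    let ?h = "\<lambda>z. cmod (f z) powr p * (1 - (cmod z)\<^sup>2) powr \<alpha>"
    let ?B = "\<integral>\<^sup>+ z. ennreal (?h z) \<partial>disc_area"
    show "arc_length_integral g (\<lambda>z. cmod (f z) powr p * (1 - (cmod z)\<^sup>2) powr (1 + \<alpha>)) \<le> ennreal K * ?B"
    proof (cases "?B = \<infinity>")
      case True then show ?thesis using K by (simp add: ennreal_mult_top)
    next
      case False
      then obtain b where b: "0 \<le> b" "?B = ennreal b" by (cases ?B) auto
      have cont: "continuous_on unit_disc ?h"
        using complex_harmonic_on_imp_continuous_on[OF harm] \<open>0 < p\<close>
        by (intro continuous_intros continuous_on_powr') (auto simp: power_less_one_iff abs_square_eq_1)
      have "(\<lambda>z. indicator unit_disc z *\<^sub>R ?h z) \<in> borel_measurable borel"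
        by (rule borel_measurable_continuous_on_indicator[OF _ cont]) simp
      then have "(\<lambda>z. ennreal (indicator unit_disc z *\<^sub>R ?h z)) \<in> borel_measurable lborel"
        by simp
      moreover have "(\<lambda>z. ennreal (indicator unit_disc z *\<^sub>R ?h z)) =
          (\<lambda>z. ennreal (?h z) * indicator unit_disc z)"
        by (auto simp: fun_eq_iff indicator_def)
      ultimately have meas: "(\<lambda>z. ennreal (?h z) * indicator unit_disc z) \<in> borel_measurable lborel"
        by (simp only:)
      from cont have "ennreal b = ennreal (1 / pi) * (\<integral>\<^sup>+ z. ennreal (?h z) * indicator unit_disc z \<partial>lborel)"
        using nn_integral_disc_area b(2) by metis
      then have "ennreal pi * ennreal b = ennreal (pi * (1 / pi)) * (\<integral>\<^sup>+ z. ennreal (?h z) * indicator unit_disc z \<partial>lborel)"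
        by (simp only: ennreal_mult' mult.assoc pi_ge_zero)
      then have int: "(\<integral>\<^sup>+ z. ennreal (?h z) * indicator unit_disc z \<partial>lborel) = ennreal (pi * b)"
        using b(1) by (simp add: ennreal_mult')
      \<comment> \<open>On the disc about \<open>w\<close> the weight is at least \<open>m\<close>,
        so the unweighted integral there is at most the weighted one over the unit disc divided by
        \<open>m\<close>.\<close>
      have bound: "cmod (f w) powr p \<le> pi * b / (m * (\<kappa> * \<delta>\<^sup>2))" if w: "w \<in> C" for w
      proof -
        have "(\<integral>\<^sup>+ z. ennreal (cmod (f z) powr p) * indicator (cball w \<delta>) z \<partial>lborel) \<le>
            (\<integral>\<^sup>+ z. ennreal (1 / m) * (ennreal (?h z) * indicator unit_disc z) \<partial>lborel)"
        proof (rule nn_integral_mono)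
          fix z
          show "ennreal (cmod (f z) powr p) * indicator (cball w \<delta>) z \<le>
            ennreal (1 / m) * (ennreal (?h z) * indicator unit_disc z)"
          proof (cases "z \<in> cball w \<delta>")
            case True
            then have z: "cmod z \<le> r" using sub[OF w] by auto
            have "cmod (f z) powr p * m \<le> ?h z" by (intro mult_left_mono wt z) simp
            then have "cmod (f z) powr p \<le> 1 / m * ?h z" using m by (simp add: field_simps)
            then have "ennreal (cmod (f z) powr p) \<le> ennreal (1 / m) * ennreal (?h z)"
              using m by (simp add: ennreal_leI flip: ennreal_mult')
            then show ?thesis using True z r by simp
          qed simp
        qed
        also have "\<dots> = ennreal (1 / m) * (\<integral>\<^sup>+ z. ennreal (?h z) * indicator unit_disc z \<partial>lborel)"
          by (rule nn_integral_cmult[OF meas])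
        also have "\<dots> = ennreal (pi * b / m)"
          unfolding int using m b(1) by (simp flip: ennreal_mult')
        finally have "\<kappa> * \<delta>\<^sup>2 * cmod (f w) powr p \<le> pi * b / m"
          using m b(1) sub[OF w] r by (intro \<kappa>(2)[OF harm \<delta>(1)]) auto
        then show ?thesis using m \<kappa>(1) \<delta>(1) by (simp add: field_simps)
      qed
      have "arc_length_integral g (\<lambda>z. cmod (f z) powr p * (1 - (cmod z)\<^sup>2) powr (1 + \<alpha>)) \<le>
          8 * ennreal (pi * b / (m * (\<kappa> * \<delta>\<^sup>2)))"
      proof (rule arc_length_integral_le)
        show "path_length_between g 0 1 \<le> 8" by (rule convex_curve_path_length_le) fact+
        fix z assume "z \<in> path_image g"
        then have z: "z \<in> C" using g by (simp add: simple_closed_param_def)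
        then have "cmod z < 1" using assms(4) by auto
        \<comment> \<open>The exponent is positive and the base lies between 0 and 1, so the weight
          on the curve may be dropped.\<close>
        then have "(1 - (cmod z)\<^sup>2) powr (1 + \<alpha>) \<le> 1"
          using assms(2) by (intro powr_le1) (auto simp: power_le_one)
        then have "cmod (f z) powr p * (1 - (cmod z)\<^sup>2) powr (1 + \<alpha>) \<le> cmod (f z) powr p"
          by (intro mult_left_le) auto
        then show "ennreal (cmod (f z) powr p * (1 - (cmod z)\<^sup>2) powr (1 + \<alpha>)) \<le> ennreal (pi * b / (m * (\<kappa> * \<delta>\<^sup>2)))"
          using bound[OF z] by (intro ennreal_leI) linarith
      qed
      also have "\<dots> = ennreal K * ennreal b"
      proof -
        have "8 * ennreal (pi * b / (m * (\<kappa> * \<delta>\<^sup>2))) = ennreal (8 * (pi * b / (m * (\<kappa> * \<delta>\<^sup>2))))"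
          by (simp only: ennreal_mult'[OF zero_le_numeral] ennreal_numeral)
        also have "\<dots> = ennreal K * ennreal b"
          using K by (simp add: K_def mult.assoc flip: ennreal_mult')
        finally show ?thesis .
      qed
      finally show ?thesis using b(2) by simp
    qed
  qed
qed

end
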